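(* Let $f,g,F,h,\mathcal{C}$ be as in the context (with $F=f+g$ and $F^*=\inf F>-\infty$). Suppose that for every $\gamma>0$ and $x\in\mathcal{C}\cap\mathrm{dom}\,g$ the set $\operatorname{argmin}_{y\in\mathbb{E}}\{\langle\nabla f(x),y\rangle+\gamma D_h(y,x)+g(y)\}$ is nonempty and included in $\mathcal{C}\cap\mathrm{dom}\,g$, and that there exists $L_h>0$ such that $$f(x)\le f(y)+\langle\nabla f(y),x-y\rangle+L_hD_h(x,y)\quad\text{for all }x,y\in\mathcal{C}\cap\mathrm{dom}\,g.$$ Assume further that $h$ is $\sigma$-strongly convex with $\sigma>0$, namely $D_h(x,y)\ge\frac{\sigma}{2}\|x-y\|^2$ for all $x\in\mathbb{E}$, $y\in\mathcal{C}$. Let $\{x^k\}$ be a sequence generated by the auto-conditioned Bregman proximal gradient method (AC-BPGM) with parameters $\alpha>1$, $L_0>0$ and $x^0\in\mathcal{C}\cap\mathrm{dom}\,g$, satisfying $x^k\ne x^{k-1}$ for all $k\ge1$. Then: (i) For all $k\ge1$, $$\min_{1\le l\le k}\|R_{\alpha\gamma_l}(x^{l-1})\|\le\sqrt{\frac{4\alpha^2\max\{L_0,L_h\}(\Delta+C)}{(\alpha-1)\sigma k}}=\mathcal{O}\left(k^{-\frac12}\right),$$ where $\Delta:=F(x^0)-F^*$ and $C:=(\max\{L_0,L_h\}-L_0)\max_{l\in\overline{\mathcal{S}}}D_h(x^l,x^{l-1})<\infty$. (ii) The sequence $\{F(x^k)\}$ converges to a finite value. (iii) If $\mathcal{C}=\mathbb{E}$,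 then any accumulation point of $\{x^k\}$ is an l-stationary point of the problem of minimizing $F$ over $\mathbb{E}$.
   Context: $\mathbb{E}$ is a finite-dimensional real inner product space with inner product $\langle\cdot,\cdot\rangle$ and induced norm $\|\cdot\|$; $\mathrm{dom}\,\phi=\{x\mid\phi(x)<\infty\}$. Problem: minimize $F(x):=f(x)+g(x)$ over $x\in\mathbb{E}$, where $f:\mathbb{E}\to(-\infty,\infty]$ is lower semicontinuous and continuously differentiable on an open set including $\mathrm{dom}\,g$, $g:\mathbb{E}\to(-\infty,\infty]$ is proper and lower semicontinuous, and $F^*:=\inf_{x\in\mathbb{E}}F(x)>-\infty$. Kernel: $h:\mathbb{E}\to(-\infty,\infty]$ is a lower semicontinuous strictly convex function that is continuously differentiable on $\mathcal{C}:=\mathrm{int}\,\mathrm{dom}\,h$. The Bregman divergence is $D_h(x,y)=h(x)-h(y)-\langle\nabla h(y),x-y\rangle$ if $y\in\mathcal{C}$, and $D_h(x,y)=\infty$ if $y\notin\mathcal{C}$. Subdifferentials: for $x\in\mathrm{dom}\,F=\mathrm{dom}\,g$, the Fréchet subdifferential is $\widehat\partial F(x)=\{\xi\in\mathbb{E}\mid\liminf_{y\to x}\frac{F(y)-F(x)-\langle\xi,y-x\rangle}{\|y-x\|}\ge0\}$, with $\widehat\partial F(x)=\emptyset$ for $x\notin\mathrm{dom}\,g$; the limiting subdifferential is $\partial F(x)=\{\xi\mid\exists\,x^k\to x,\ F(x^k)\to F(x),\ \xi^k\to\xi,\ \xi^k\in\widehat\partial F(x^k)\}$. An l-stationary point is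 a point $x^*\in\mathrm{dom}\,g$ with $0\in\partial F(x^* )$. AC-BPGM: given $x^0\in\mathcal{C}\cap\mathrm{dom}\,g$, $\alpha>1$, $L_0>0$, for $k=1,2,\dots$ compute $\gamma_k=\max\{L_0,\dots,L_{k-1}\}$; $x^k\in\operatorname{argmin}_{y\in\mathbb{E}}\{\langle\nabla f(x^{k-1}),y\rangle+\alpha\gamma_kD_h(y,x^{k-1})+g(y)\}$ (any choice); $L_k=\dfrac{f(x^k)-f(x^{k-1})-\langle\nabla f(x^{k-1}),x^k-x^{k-1}\rangle}{D_h(x^k,x^{k-1})}$. Along the iterates, $R_{\alpha\gamma_k}(x^{k-1}):=\alpha\gamma_k(x^{k-1}-x^k)$. Index sets: with $\beta:=\frac{\alpha+1}{2}$, $\mathcal{S}:=\{k\ge1\mid\beta\gamma_k\ge L_k\}$ and $\overline{\mathcal{S}}:=\{1,2,\dots\}\setminus\mathcal{S}$. A maximum over the empty set is taken to be $0$. *)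

theory Defs
  imports "HOL-Analysis.Analysis" "HOL-Library.Landau_Symbols"
begin

definition edom :: "('a \<Rightarrow> ereal) \<Rightarrow> 'a set" where
  "edom \<phi> = {x. \<phi> x < \<infinity>}"

text \<open>A function into \<open>(-\<infinity>, \<infinity>]\<close> is an \<^typ>\<open>ereal\<close>-valued function that avoids \<open>-\<infinity>\<close>.\<close>

definition no_minfty :: "('a \<Rightarrow> ereal) \<Rightarrow> bool" where
  "no_minfty \<phi> \<longleftrightarrow> (\<forall>x. \<phi> x > -\<infinity>)"

definition proper_fun :: "('a \<Rightarrow> ereal) \<Rightarrow> bool" where
  "proper_fun \<phi> \<longleftrightarrow> no_minfty \<phi> \<and> edom \<phi> \<noteq> {}"

definition lower_semicont :: "('a::topological_space \<Rightarrow> ereal) \<Rightarrow> bool" where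
  "lower_semicont \<phi> \<longleftrightarrow> (\<forall>x. \<phi> x \<le> Liminf (at x) \<phi>)"

text \<open>Strict convexity is required on the effective domain; elsewhere the convexity
  inequality holds trivially, its right-hand side being \<open>\<infinity>\<close>.\<close>

definition strictly_convex_fun :: "('a::real_vector \<Rightarrow> ereal) \<Rightarrow> bool" where
  "strictly_convex_fun \<phi> \<longleftrightarrow>
     (\<forall>x\<in>edom \<phi>. \<forall>y\<in>edom \<phi>. \<forall>t::real. x \<noteq> y \<and> 0 < t \<and> t < 1 \<longrightarrow>
        \<phi> ((1 - t) *\<^sub>R x + t *\<^sub>R y) < ereal (1 - t) * \<phi> x + ereal t * \<phi> y)"

text \<open>\<^const>\<open>real_of_ereal\<close> sends infinite values to \<open>0\<close>, so \<open>egrad \<phi> x\<close> is meaningful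
  only where \<open>\<phi>\<close> is finite in a neighbourhood of \<open>x\<close>; this is
  ensured by the finiteness clause of \<open>C1_on\<close>, which is used for open sets.\<close>

definition egrad :: "('a::real_inner \<Rightarrow> ereal) \<Rightarrow> 'a \<Rightarrow> 'a" where
  "egrad \<phi> x = (THE D. GDERIV (\<lambda>y. real_of_ereal (\<phi> y)) x :> D)"

definition C1_on :: "('a::real_inner \<Rightarrow> ereal) \<Rightarrow> 'a set \<Rightarrow> bool" where
  "C1_on \<phi> U \<longleftrightarrow>
     (\<forall>x\<in>U. \<bar>\<phi> x\<bar> \<noteq> \<infinity>) \<and>
     (\<forall>x\<in>U. \<exists>D. GDERIV (\<lambda>y. real_of_ereal (\<phi> y)) x :> D) \<and>
     continuous_on U (egrad \<phi>)"

definition frechet_subdiff :: "('a::real_inner \<Rightarrow> ereal) \<Rightarrow> 'a \<Rightarrow> 'a set" where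
  "frechet_subdiff \<phi> x =
     (if x \<in> edom \<phi>
      then {\<xi>. Liminf (at x) (\<lambda>y. (\<phi> y - \<phi> x - ereal (\<xi> \<bullet> (y - x))) / ereal (norm (y - x))) \<ge> 0}
      else {})"

definition limiting_subdiff :: "('a::real_inner \<Rightarrow> ereal) \<Rightarrow> 'a \<Rightarrow> 'a set" where
  "limiting_subdiff \<phi> x =
     {\<xi>. \<exists>xs \<xi>s. xs \<longlonglongrightarrow> x \<and> (\<lambda>k. \<phi> (xs k)) \<longlonglongrightarrow> \<phi> x \<and> \<xi>s \<longlonglongrightarrow> \<xi> \<and>
          (\<forall>k::nat. \<xi>s k \<in> frechet_subdiff \<phi> (xs k))}"

definition l_stationary :: "('a::real_inner \<Rightarrow> ereal) \<Rightarrow> ('a \<Rightarrow> ereal) \<Rightarrow> 'a \<Rightarrow> bool" where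
  "l_stationary f g x \<longleftrightarrow> x \<in> edom g \<and> 0 \<in> limiting_subdiff (\<lambda>y. f y + g y) x"

definition accumulation_point :: "(nat \<Rightarrow> 'a::topological_space) \<Rightarrow> 'a \<Rightarrow> bool" where
  "accumulation_point x z \<longleftrightarrow> (\<exists>r. strict_mono r \<and> (x \<circ> r) \<longlonglongrightarrow> z)"

definition bregman :: "('a::real_inner \<Rightarrow> ereal) \<Rightarrow> 'a \<Rightarrow> 'a \<Rightarrow> ereal" where
  "bregman h x y =
     (if y \<in> interior (edom h) then h x - h y - ereal (egrad h y \<bullet> (x - y)) else \<infinity>)"

definition bpg_argmin ::
  "('a::real_inner \<Rightarrow> ereal) \<Rightarrow> ('a \<Rightarrow> ereal) \<Rightarrow> ('a \<Rightarrow> ereal) \<Rightarrow> real \<Rightarrow> 'a \<Rightarrow> 'a set" where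
  "bpg_argmin f g h \<gamma> x =
     {y. is_arg_min (\<lambda>z. ereal (egrad f x \<bullet> z) + ereal \<gamma> * bregman h z x + g z) (\<lambda>_. True) y}"

text \<open>\<open>AC_L f h L0 x k\<close> and \<open>AC_gamma f h L0 x k\<close> are the quantities \<open>L\<^sub>k\<close> (\<open>k \<ge> 0\<close>) and
  \<open>\<gamma>\<^sub>k\<close> (\<open>k \<ge> 1\<close>) determined by the iterates \<open>x\<close>. If \<open>x k\<close> and \<open>x (k - 1)\<close> are distinct points
  of \<open>interior (edom h)\<close> at which \<open>f\<close> is finite and \<open>h\<close> is strictly convex without value \<open>-\<infinity>\<close>,
  then the conversions to reals lose nothing and the denominator is nonzero.\<close>

definition AC_L :: "('a::real_inner \<Rightarrow> ereal) \<Rightarrow> ('a \<Rightarrow> ereal) \<Rightarrow> real \<Rightarrow> (nat \<Rightarrow> 'a) \<Rightarrow> nat \<Rightarrow> real" where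
  "AC_L f h L0 x k =
     (if k = 0 then L0
      else (real_of_ereal (f (x k)) - real_of_ereal (f (x (k - 1)))
              - egrad f (x (k - 1)) \<bullet> (x k - x (k - 1)))
           / real_of_ereal (bregman h (x k) (x (k - 1))))"

definition AC_gamma :: "('a::real_inner \<Rightarrow> ereal) \<Rightarrow> ('a \<Rightarrow> ereal) \<Rightarrow> real \<Rightarrow> (nat \<Rightarrow> 'a) \<Rightarrow> nat \<Rightarrow> real" where
  "AC_gamma f h L0 x k = Max (AC_L f h L0 x ` {..<k})"

definition AC_BPGM ::
  "('a::real_inner \<Rightarrow> ereal) \<Rightarrow> ('a \<Rightarrow> ereal) \<Rightarrow> ('a \<Rightarrow> ereal) \<Rightarrow> real \<Rightarrow> real \<Rightarrow> (nat \<Rightarrow> 'a) \<Rightarrow> bool" where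
  "AC_BPGM f g h \<alpha> L0 x \<longleftrightarrow>
     \<alpha> > 1 \<and> L0 > 0 \<and> x 0 \<in> interior (edom h) \<inter> edom g \<and>
     (\<forall>k\<ge>1. x k \<in> bpg_argmin f g h (\<alpha> * AC_gamma f h L0 x k) (x (k - 1)))"

definition AC_R ::
  "('a::real_inner \<Rightarrow> ereal) \<Rightarrow> ('a \<Rightarrow> ereal) \<Rightarrow> real \<Rightarrow> real \<Rightarrow> (nat \<Rightarrow> 'a) \<Rightarrow> nat \<Rightarrow> 'a" where
  "AC_R f h \<alpha> L0 x k = (\<alpha> * AC_gamma f h L0 x k) *\<^sub>R (x (k - 1) - x k)"

definition AC_S ::
  "('a::real_inner \<Rightarrow> ereal) \<Rightarrow> ('a \<Rightarrow> ereal) \<Rightarrow> real \<Rightarrow> real \<Rightarrow> (nat \<Rightarrow> 'a) \<Rightarrow> nat set" where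
  "AC_S f h \<alpha> L0 x = {k. 1 \<le> k \<and> (\<alpha> + 1) / 2 * AC_gamma f h L0 x k \<ge> AC_L f h L0 x k}"

definition AC_Sbar ::
  "('a::real_inner \<Rightarrow> ereal) \<Rightarrow> ('a \<Rightarrow> ereal) \<Rightarrow> real \<Rightarrow> real \<Rightarrow> (nat \<Rightarrow> 'a) \<Rightarrow> nat set" where
  "AC_Sbar f h \<alpha> L0 x = {1..} - AC_S f h \<alpha> L0 x"

text \<open>The maximum of \<open>d\<close> over \<open>A\<close>, taken as \<open>0\<close> for empty \<open>A\<close>. The index set is not assumed finite
  (\<^const>\<open>Max\<close> is unspecified on infinite sets), hence the supremum in \<^typ>\<open>ereal\<close>; that it is
  attained is the separate predicate \<open>max_attained\<close>.\<close>

definition max_or_0 :: "nat set \<Rightarrow> (nat \<Rightarrow> ereal) \<Rightarrow> ereal" where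
  "max_or_0 A d = (if A = {} then 0 else (SUP l\<in>A. d l))"

definition max_attained :: "nat set \<Rightarrow> (nat \<Rightarrow> ereal) \<Rightarrow> bool" where
  "max_attained A d \<longleftrightarrow> A = {} \<or> (\<exists>l\<in>A. \<forall>m\<in>A. d m \<le> d l)"

end

theory Submission
  imports Defs
begin

text \<open>Testing the optimality of \<open>x\<^sup>k\<close> against \<open>x\<^sup>k\<^sup>-\<^sup>1\<close> gives
  \<open>F(x\<^sup>k) \<le> F(x\<^sup>k\<^sup>-\<^sup>1) - (\<alpha>\<gamma>\<^sub>k - L\<^sub>k) D\<^sub>h(x\<^sup>k, x\<^sup>k\<^sup>-\<^sup>1)\<close>. An index outside \<open>S\<close> pushes \<open>\<gamma>\<close> up by the factor
  \<open>\<beta> > 1\<close>, and \<open>\<gamma>\<close> is bounded by \<open>max {L\<^sub>0, L\<^sub>h}\<close>, so there are finitely many of them and their total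
  excess telescopes in \<open>\<gamma>\<close>. Hence \<open>\<Sum> \<gamma>\<^sub>k D\<^sub>h(x\<^sup>k, x\<^sup>k\<^sup>-\<^sup>1)\<close> is bounded, which yields the rate and
  \<open>x\<^sup>k - x\<^sup>k\<^sup>-\<^sup>1 \<longrightarrow> 0\<close>; \<open>F(x\<^sup>k)\<close> is eventually nonincreasing and so converges. At an accumulation point
  \<open>z\<close>, testing optimality against \<open>z\<close> gives \<open>g(x\<^sup>k) \<longrightarrow> g(z)\<close>, and
  \<open>\<nabla>f(x\<^sup>k) - \<nabla>f(x\<^sup>k\<^sup>-\<^sup>1) - \<alpha>\<gamma>\<^sub>k (\<nabla>h(x\<^sup>k) - \<nabla>h(x\<^sup>k\<^sup>-\<^sup>1))\<close> are Frechet subgradients of \<open>F\<close> tending to \<open>0\<close>.\<close>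

section \<open>Gradients, lower semicontinuity and Frechet subgradients of extended-valued
  functions\<close>

lemma C1_on_GDERIV:
  assumes "C1_on \<phi> U" "p \<in> U"
  shows "GDERIV (\<lambda>y. real_of_ereal (\<phi> y)) p :> egrad \<phi> p"
proof -
  obtain D where D: "GDERIV (\<lambda>y. real_of_ereal (\<phi> y)) p :> D"
    using assms by (auto simp: C1_on_def)
  have "D' = D" if "GDERIV (\<lambda>y. real_of_ereal (\<phi> y)) p :> D'" for D'
  proof -
    have "(\<lambda>v. v \<bullet> D') = (\<lambda>v. v \<bullet> D)"
      using that D unfolding gderiv_def by (rule has_derivative_unique)
    then have "\<forall>v. v \<bullet> D' = v \<bullet> D"
      by meson
    then show ?thesis
      by (metis vector_eq_ldot)
  qed
  with D have "egrad \<phi> p = D"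
    unfolding egrad_def by (rule the_equality)
  with D show ?thesis by simp
qed

lemma GDERIV_imp_isCont:
  assumes "GDERIV q p :> \<xi>"
  shows "isCont q p"
  using assms unfolding gderiv_def by (rule has_derivative_continuous)

lemma C1_on_real_of_ereal: "C1_on \<phi> U \<Longrightarrow> p \<in> U \<Longrightarrow> ereal (real_of_ereal (\<phi> p)) = \<phi> p"
  by (auto simp: C1_on_def ereal_real)

lemma lower_semicont_eventually:
  assumes "lower_semicont \<phi>" "b < \<phi> z" "xs \<longlonglongrightarrow> z"
  shows "eventually (\<lambda>j. b < \<phi> (xs j)) sequentially"
proof -
  have "\<phi> z \<le> Liminf (at z) \<phi>"
    using assms(1) by (auto simp: lower_semicont_def)
  then have "eventually (\<lambda>y. b < \<phi> y) (at z)"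
    using assms(2) by (auto simp: le_Liminf_iff)
  \<comment> \<open>\<open>at z\<close> leaves out \<open>z\<close> itself, where the bound holds by
    hypothesis; the sequence may therefore visit \<open>z\<close>.\<close>
  then have "eventually (\<lambda>y. b < \<phi> y) (nhds z)"
    using assms(2) by (simp add: eventually_nhds_conv_at)
  then show ?thesis
    using assms(3) by (rule eventually_compose_filterlim)
qed

text \<open>The limit bound is real although finiteness of \<open>\<phi> z\<close> is not known
  beforehand; this is how an accumulation point is placed in \<open>edom g\<close>.\<close>

lemma lower_semicont_le_lim:
  assumes "lower_semicont \<phi>" "xs \<longlonglongrightarrow> z" "\<And>j. \<phi> (xs j) \<le> ereal (a j)" "a \<longlonglongrightarrow> A"
  shows "\<phi> z \<le> ereal A"
proof (rule dense_le)
  fix b assume "b < \<phi> z"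
  then have "eventually (\<lambda>j. b < \<phi> (xs j)) sequentially"
    using assms lower_semicont_eventually by blast
  then have "eventually (\<lambda>j. b \<le> ereal (a j)) sequentially"
    by eventually_elim (use assms(3) order.strict_implies_order order.trans in blast)
  moreover have "(\<lambda>j. ereal (a j)) \<longlonglongrightarrow> ereal A"
    using assms(4) by simp
  ultimately show "b \<le> ereal A"
    by (intro tendsto_lowerbound) auto
qed

text \<open>The difference quotient of \<open>\<phi>\<close> dominates that of \<open>q\<close>,
  whose first-order remainder vanishes. Only increments are compared, so \<open>q\<close> need not
  agree with \<open>\<phi>\<close> at \<open>p\<close>.\<close>

lemma frechet_subdiff_of_smooth_minorant:
  assumes fin: "\<bar>\<phi> p\<bar> \<noteq> \<infinity>"
    and q: "GDERIV q p :> \<xi>"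
    and minorant: "eventually (\<lambda>y. \<phi> p + ereal (q y - q p) \<le> \<phi> y) (at p)"
  shows "\<xi> \<in> frechet_subdiff \<phi> p"
proof -
  obtain c where c: "\<phi> p = ereal c"
    using fin by auto
  have "((\<lambda>y. (q y - q p - \<xi> \<bullet> (y - p)) / norm (y - p)) \<longlongrightarrow> 0) (at p)"
    using q unfolding gderiv_def has_derivative_at_within
    by (simp add: inner_commute divide_inverse algebra_simps)
  then have lim: "((\<lambda>y. ereal ((q y - q p - \<xi> \<bullet> (y - p)) / norm (y - p))) \<longlongrightarrow> 0) (at p)"
    by (simp add: zero_ereal_def)
  have "0 \<le> Liminf (at p) (\<lambda>y. (\<phi> y - \<phi> p - ereal (\<xi> \<bullet> (y - p))) / ereal (norm (y - p)))"
    unfolding le_Liminf_iff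
  proof (intro allI impI)
    fix b :: ereal assume "b < 0"
    with lim have ev: "eventually (\<lambda>y. b < ereal ((q y - q p - \<xi> \<bullet> (y - p)) / norm (y - p))) (at p)"
      by (rule order_tendstoD)
    have ne: "eventually (\<lambda>y. y \<noteq> p) (at p)"
      by (simp add: eventually_at_filter)
    from ev minorant ne
    show "eventually (\<lambda>y. b < (\<phi> y - \<phi> p - ereal (\<xi> \<bullet> (y - p))) / ereal (norm (y - p))) (at p)"
    proof eventually_elim
      case (elim y)
      have "ereal (q y - q p - \<xi> \<bullet> (y - p)) \<le> \<phi> y - \<phi> p - ereal (\<xi> \<bullet> (y - p))"
        using elim(2) c by (cases "\<phi> y") auto
      then have "ereal (q y - q p - \<xi> \<bullet> (y - p)) / ereal (norm (y - p))
          \<le> (\<phi> y - \<phi> p - ereal (\<xi> \<bullet> (y - p))) / ereal (norm (y - p))"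
        using elim(3) by (intro ereal_divide_right_mono) auto
      with elim(1,3) show ?case by simp
    qed
  qed
  then show ?thesis
    using c by (simp add: frechet_subdiff_def edom_def)
qed

section \<open>Descent with auto-conditioned parameters, for real sequences\<close>

locale auto_conditioned_descent =
  fixes L D \<Phi> :: "nat \<Rightarrow> real" and \<alpha> M m :: real
  assumes alpha: "1 < \<alpha>"
    and L_0: "0 < L 0"
    and L_le: "L k \<le> M"
    and D_nonneg: "0 \<le> D (Suc k)"
    and descent: "\<Phi> (Suc k) \<le> \<Phi> k - (\<alpha> * Max (L ` {..<Suc k}) - L (Suc k)) * D (Suc k)"
    and lower: "m \<le> \<Phi> k"
begin

text \<open>\<open>gam 0\<close> is the \<open>Max\<close> of the empty set, hence unspecified; this
  explains the side conditions \<open>1 \<le> k\<close> below.\<close>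

definition gam :: "nat \<Rightarrow> real" where "gam k = Max (L ` {..<k})"

definition Sbar :: "nat set" where "Sbar = {k. 1 \<le> k \<and> (\<alpha> + 1) / 2 * gam k < L k}"

lemma gam_one: "gam (Suc 0) = L 0"
  by (simp add: gam_def lessThan_Suc)

lemma gam_ge: "i < k \<Longrightarrow> L i \<le> gam k"
  by (auto simp: gam_def)

lemma gam_pos: "1 \<le> k \<Longrightarrow> 0 < gam k"
  using gam_ge[of 0 k] L_0 by simp

lemma gam_le: "1 \<le> k \<Longrightarrow> gam k \<le> M"
  using L_le by (auto simp: gam_def lessThan_empty_iff intro!: Max.boundedI)

lemma gam_Suc_ge: "1 \<le> k \<Longrightarrow> gam k \<le> gam (Suc k)"
  unfolding gam_def by (rule Max_mono) (auto simp: lessThan_empty_iff)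

text \<open>Since \<open>gam\<close> is nondecreasing, increments over any finite index set are
  dominated by a full telescoping sum, which starts at \<open>gam 1 = L 0\<close> and ends below
  \<open>M\<close>.\<close>

lemma sum_gam_diff_le:
  assumes "finite T" "T \<subseteq> {1..}"
  shows "(\<Sum>l\<in>T. gam (Suc l) - gam l) \<le> M - L 0"
proof -
  define k where "k = Max (insert 1 T)"
  have T: "T \<subseteq> {1..k}"
    using assms by (auto simp: k_def)
  have k: "1 \<le> k"
    using assms by (auto simp: k_def)
  have "(\<Sum>l\<in>T. gam (Suc l) - gam l) \<le> (\<Sum>l=1..k. gam (Suc l) - gam l)"
    using T gam_Suc_ge by (intro sum_mono2) auto
  also have "\<dots> = gam (Suc k) - gam 1"
    using k by (intro sum_Suc_diff) auto
  also have "\<dots> \<le> M - L 0"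
    using gam_le[of "Suc k"] gam_one by simp
  finally show ?thesis .
qed

text \<open>With \<beta> = (\<alpha> + 1) / 2, each index in \<open>Sbar\<close> raises
  \<open>gam\<close> by at least (\<beta> - 1) times \<open>L 0\<close>, while the total rise is at
  most \<open>M - L 0\<close>. This bounds the cardinality of finite subsets of \<open>Sbar\<close>
  uniformly.\<close>

lemma finite_Sbar: "finite Sbar"
proof -
  have "card T \<le> nat \<lceil>(M - L 0) / ((\<alpha> - 1) / 2 * L 0)\<rceil>" if T: "T \<subseteq> Sbar" "finite T" for T
  proof -
    have "(\<alpha> - 1) / 2 * L 0 \<le> gam (Suc l) - gam l" if "l \<in> T" for l
    proof -
      have l: "1 \<le> l" "(\<alpha> + 1) / 2 * gam l < L l"
        using that T by (auto simp: Sbar_def)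
      have "(\<alpha> - 1) / 2 * L 0 \<le> (\<alpha> - 1) / 2 * gam l"
        using gam_ge[of 0 l] l alpha by (intro mult_left_mono) auto
      also have "\<dots> = (\<alpha> + 1) / 2 * gam l - gam l"
        by (simp add: field_simps)
      also have "\<dots> \<le> gam (Suc l) - gam l"
        using l gam_ge[of l "Suc l"] by simp
      finally show ?thesis .
    qed
    then have "real (card T) * ((\<alpha> - 1) / 2 * L 0) \<le> (\<Sum>l\<in>T. gam (Suc l) - gam l)"
      by (rule sum_bounded_below)
    also have "\<dots> \<le> M - L 0"
      using T by (intro sum_gam_diff_le) (auto simp: Sbar_def)
    finally have "real (card T) \<le> (M - L 0) / ((\<alpha> - 1) / 2 * L 0)"
      using alpha L_0 by (simp add: pos_le_divide_eq)
    then show ?thesis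
      by linarith
  qed
  then show ?thesis
    by (rule finite_if_finite_subsets_card_bdd[THEN conjunct1])
qed

lemma descent_gam: "\<Phi> (Suc k) \<le> \<Phi> k - (\<alpha> * gam (Suc k) - L (Suc k)) * D (Suc k)"
  using descent by (simp add: gam_def)

text \<open>Outside \<open>Sbar\<close> the descent coefficient is at least (\<alpha> - \<beta>)
  \<open>gam (Suc k)\<close>, and \<alpha> - \<beta> = (\<alpha> - 1) / 2 because \<beta> is the
  midpoint of 1 and \<alpha>.\<close>

lemma descent_good:
  assumes "Suc k \<notin> Sbar"
  shows "(\<alpha> - 1) / 2 * (gam (Suc k) * D (Suc k)) \<le> \<Phi> k - \<Phi> (Suc k)"
proof -
  have "L (Suc k) * D (Suc k) \<le> ((\<alpha> + 1) / 2 * gam (Suc k)) * D (Suc k)"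
    using assms D_nonneg by (intro mult_right_mono) (auto simp: Sbar_def)
  with descent_gam[of k] show ?thesis
    by (simp add: field_simps)
qed

text \<open>The excess of \<open>L (Suc k)\<close> over \<beta> \<open>gam (Suc k)\<close> is
  charged to the next increment of \<open>gam\<close>, because \<open>L (Suc k)\<close> enters the
  following maximum and \<beta> \<ge> 1.\<close>

lemma descent_bad:
  "(\<alpha> - 1) / 2 * (gam (Suc k) * D (Suc k))
    \<le> \<Phi> k - \<Phi> (Suc k) + (gam (Suc (Suc k)) - gam (Suc k)) * D (Suc k)"
proof -
  have "1 * gam (Suc k) \<le> (\<alpha> + 1) / 2 * gam (Suc k)"
    using alpha gam_pos[of "Suc k"] by (intro mult_right_mono) auto
  then have "(L (Suc k) - (\<alpha> + 1) / 2 * gam (Suc k)) * D (Suc k)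
      \<le> (gam (Suc (Suc k)) - gam (Suc k)) * D (Suc k)"
    using D_nonneg gam_ge[of "Suc k" "Suc (Suc k)"] by (intro mult_right_mono) auto
  with descent_gam[of k] show ?thesis
    by (simp add: field_simps)
qed

lemma energy_bound:
  "(\<alpha> - 1) / 2 * (\<Sum>l=1..k. gam l * D l)
    \<le> \<Phi> 0 - \<Phi> k + (\<Sum>l\<in>Sbar \<inter> {1..k}. (gam (Suc l) - gam l) * D l)"
proof (induction k)
  case (Suc k)
  have lhs: "(\<alpha> - 1) / 2 * (\<Sum>l=1..Suc k. gam l * D l) =
      (\<alpha> - 1) / 2 * (\<Sum>l=1..k. gam l * D l) + (\<alpha> - 1) / 2 * (gam (Suc k) * D (Suc k))"
    by (simp add: distrib_left)
  show ?case
  proof (cases "Suc k \<in> Sbar")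
    case True
    then have "Sbar \<inter> {1..Suc k} = insert (Suc k) (Sbar \<inter> {1..k})"
      by auto
    with lhs Suc descent_bad[of k] show ?thesis
      by simp
  next
    case False
    then have "Sbar \<inter> {1..Suc k} = Sbar \<inter> {1..k}"
      by (auto simp: le_Suc_eq)
    with lhs Suc descent_good[OF False] show ?thesis
      by simp
  qed
qed simp

text \<open>The charges telescope once each \<open>D l\<close> over \<open>Sbar\<close> is replaced
  by \<open>Dmax\<close>; the term \<open>(M - L 0) * Dmax\<close> becomes the constant
  \<open>Cst\<close> of the theorem.\<close>

lemma sum_gam_D_le:
  assumes "\<And>l. l \<in> Sbar \<Longrightarrow> D l \<le> Dmax" "0 \<le> Dmax"
  shows "(\<alpha> - 1) / 2 * (\<Sum>l=1..k. gam l * D l) \<le> \<Phi> 0 - m + (M - L 0) * Dmax"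
proof -
  have "(\<Sum>l\<in>Sbar \<inter> {1..k}. (gam (Suc l) - gam l) * D l)
      \<le> (\<Sum>l\<in>Sbar \<inter> {1..k}. (gam (Suc l) - gam l) * Dmax)"
    using assms gam_Suc_ge by (intro sum_mono mult_left_mono) auto
  also have "\<dots> = (\<Sum>l\<in>Sbar \<inter> {1..k}. gam (Suc l) - gam l) * Dmax"
    by (simp add: sum_distrib_right)
  also have "\<dots> \<le> (M - L 0) * Dmax"
    using assms by (intro mult_right_mono sum_gam_diff_le) auto
  finally show ?thesis
    using energy_bound[of k] lower[of k] by simp
qed

lemma value_convergent: "convergent \<Phi>"
proof -
  \<comment> \<open>Past \<open>N\<close> only good steps remain, so \<Phi> decreases from there on.
    Inserting 0 covers an empty \<open>Sbar\<close>.\<close>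
  define N where "N = Suc (Max (insert 0 Sbar))"
  have good: "k \<notin> Sbar" if "N \<le> k" for k
  proof
    assume "k \<in> Sbar"
    then have "k \<le> Max (insert 0 Sbar)"
      using finite_Sbar by (intro Max_ge) auto
    with that show False
      unfolding N_def by linarith
  qed
  have "decseq (\<lambda>k. \<Phi> (k + N))"
  proof (rule decseq_SucI)
    fix k
    have "0 \<le> (\<alpha> - 1) / 2 * (gam (Suc (k + N)) * D (Suc (k + N)))"
      using alpha D_nonneg gam_pos[of "Suc (k + N)"] by simp
    also have "\<dots> \<le> \<Phi> (k + N) - \<Phi> (Suc (k + N))"
      by (intro descent_good good) simp
    finally show "\<Phi> (Suc k + N) \<le> \<Phi> (k + N)" by simp
  qed
  then obtain c where "(\<lambda>k. \<Phi> (k + N)) \<longlonglongrightarrow> c"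
    using lower decseq_convergent[of "\<lambda>k. \<Phi> (k + N)" m] by blast
  then show ?thesis
    using LIMSEQ_offset convergentI by blast
qed

text \<open>As \<open>gam l \<ge> L 0 > 0\<close>, the weighted bound makes \<open>D\<close>
  summable. The sum runs over \<open>D (Suc l)\<close> because the sign of \<open>D 0\<close> is
  unspecified.\<close>

lemma D_tendsto_0: "D \<longlonglongrightarrow> 0"
proof -
  define Dmax where "Dmax = Max (insert 0 (D ` Sbar))"
  have Dmax: "\<And>l. l \<in> Sbar \<Longrightarrow> D l \<le> Dmax" "0 \<le> Dmax"
    using finite_Sbar by (auto simp: Dmax_def)
  define K where "K = (\<Phi> 0 - m + (M - L 0) * Dmax) / ((\<alpha> - 1) / 2) / L 0"
  have "(\<Sum>l<k. D (Suc l)) \<le> K" for k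
  proof -
    have "(\<Sum>l<k. D (Suc l)) = (\<Sum>l=1..k. D l)"
      by (rule sum.reindex_bij_witness[of _ "\<lambda>l. l - 1" Suc]) auto
    then have "L 0 * (\<Sum>l<k. D (Suc l)) = (\<Sum>l=1..k. L 0 * D l)"
      by (simp add: sum_distrib_left)
    also have "\<dots> \<le> (\<Sum>l=1..k. gam l * D l)"
    proof (intro sum_mono mult_right_mono)
      fix l assume "l \<in> {1..k}"
      then show "L 0 \<le> gam l" "0 \<le> D l"
        using gam_ge[of 0 l] D_nonneg[of "l - 1"] by auto
    qed
    also have "\<dots> \<le> (\<Phi> 0 - m + (M - L 0) * Dmax) / ((\<alpha> - 1) / 2)"
      using sum_gam_D_le[OF Dmax, of k] alpha by (simp add: field_simps)
    finally have "(\<Sum>l<k. D (Suc l)) * L 0 \<le> (\<Phi> 0 - m + (M - L 0) * Dmax) / ((\<alpha> - 1) / 2)"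
      by (subst mult.commute)
    then show ?thesis
      unfolding K_def pos_le_divide_eq[OF L_0] .
  qed
  then have "summable (\<lambda>l. D (Suc l))"
    using D_nonneg by (intro summableI_nonneg_bounded)
  then show ?thesis
    by (rule LIMSEQ_imp_Suc[OF summable_LIMSEQ_zero])
qed

end

section \<open>Attained maxima and optimality in the Bregman proximal step\<close>

lemma max_attained_finite:
  assumes "finite A"
  shows "max_attained A d"
proof (cases "A = {}")
  case False
  then have "Max (d ` A) \<in> d ` A"
    using assms by (intro Max_in) auto
  then obtain l where "l \<in> A" "Max (d ` A) = d l"
    by auto
  moreover have "d j \<le> Max (d ` A)" if "j \<in> A" for j
    using that assms by (intro Max_ge) auto
  ultimately show ?thesis
    by (auto simp: max_attained_def)
qed (simp add: max_attained_def)

lemma max_or_0_real: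
  fixes d :: "nat \<Rightarrow> real"
  assumes "max_attained A (\<lambda>l. ereal (d l))" "\<And>l. l \<in> A \<Longrightarrow> 0 \<le> d l"
  obtains c where "max_or_0 A (\<lambda>l. ereal (d l)) = ereal c" "0 \<le> c" "\<And>l. l \<in> A \<Longrightarrow> d l \<le> c"
proof (cases "A = {}")
  case True
  then show ?thesis
    using that[of 0] by (simp add: max_or_0_def)
next
  case False
  then obtain l where l: "l \<in> A" "\<And>j. j \<in> A \<Longrightarrow> d j \<le> d l"
    using assms(1) by (auto simp: max_attained_def)
  then have "(SUP j\<in>A. ereal (d j)) = ereal (d l)"
    by (intro SUP_eqI) auto
  then show ?thesis
    using that[of "d l"] False l assms(2) by (simp add: max_or_0_def)
qed

lemma bpg_argmin_le:
  assumes "p \<in> bpg_argmin f g h \<gamma> y"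
  shows "ereal (egrad f y \<bullet> p) + ereal \<gamma> * bregman h p y + g p
    \<le> ereal (egrad f y \<bullet> z) + ereal \<gamma> * bregman h z y + g z"
  using assms by (auto simp: bpg_argmin_def is_arg_min_def not_less)

text \<open>Minimality of \<open>p\<close> bounds increments of \<open>g\<close> below by minus
  those of the smooth part of the subproblem. Adding \<open>f\<close> makes \<open>q\<close>, which
  is \<open>f\<close> minus that smooth part, a minorant of the increments of the full objective, so
  no subdifferential sum rule is involved.\<close>

lemma bpg_argmin_frechet_subdiff:
  assumes p: "p \<in> bpg_argmin f g h \<gamma> y" "p \<in> edom g"
    and h: "edom h = UNIV" "C1_on h UNIV"
    and f: "open U" "edom g \<subseteq> U" "C1_on f U"
    and g: "no_minfty g"
  shows "egrad f p - egrad f y - \<gamma> *\<^sub>R (egrad h p - egrad h y)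
    \<in> frechet_subdiff (\<lambda>w. f w + g w) p"
proof -
  define fr where "fr = (\<lambda>w. real_of_ereal (f w))"
  define hr where "hr = (\<lambda>w. real_of_ereal (h w))"
  define q where "q w = fr w - (egrad f y \<bullet> w + \<gamma> * (hr w - egrad h y \<bullet> w))" for w
  have pU: "p \<in> U"
    using p f by auto
  have fr: "f w = ereal (fr w)" if "w \<in> U" for w
    using C1_on_real_of_ereal[OF f(3) that] by (simp add: fr_def)
  have hr: "h w = ereal (hr w)" for w
    using C1_on_real_of_ereal[OF h(2)] by (simp add: hr_def)
  obtain c where c: "g p = ereal c"
    using p(2) spec[OF g[unfolded no_minfty_def], of p] by (cases "g p") (auto simp: edom_def)
  show ?thesis
  proof (rule frechet_subdiff_of_smooth_minorant)
    show "\<bar>f p + g p\<bar> \<noteq> \<infinity>"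
      using fr[OF pU] c by simp
    have "GDERIV fr p :> egrad f p" "GDERIV hr p :> egrad h p"
      unfolding fr_def hr_def using C1_on_GDERIV f h pU by auto
    then show "GDERIV q p :> egrad f p - egrad f y - \<gamma> *\<^sub>R (egrad h p - egrad h y)"
      unfolding gderiv_def q_def
      by (auto intro!: derivative_eq_intros simp: inner_diff_right inner_commute algebra_simps)
    have "eventually (\<lambda>w. w \<in> U) (at p)"
      using f(1) pU eventually_at_topological by blast
    then show "eventually (\<lambda>w. f p + g p + ereal (q w - q p) \<le> f w + g w) (at p)"
    proof eventually_elim
      case (elim w)
      have "ereal (egrad f y \<bullet> p) + ereal \<gamma> * bregman h p y + g p
          \<le> ereal (egrad f y \<bullet> w) + ereal \<gamma> * bregman h w y + g w"
        using p(1) by (rule bpg_argmin_le)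
      moreover have "bregman h v y = ereal (hr v - hr y - egrad h y \<bullet> (v - y))" for v
        using h(1) hr by (simp add: bregman_def)
      ultimately show ?case
        using fr[OF elim] fr[OF pU] c
        by (cases "g w") (auto simp: q_def algebra_simps inner_diff_right)
    qed
  qed
qed

section \<open>Complexity, convergence of values and stationarity for AC-BPGM\<close>

theorem theorem2p4:
  fixes f g h F :: "'a::euclidean_space \<Rightarrow> ereal"
    and C :: "'a set"
    and Fstar Cst :: ereal
    and L\<^sub>h \<sigma> \<alpha> L\<^sub>0 \<Delta> :: real
    and x :: "nat \<Rightarrow> 'a"
  assumes f: "no_minfty f" "lower_semicont f"
    and f_C1: "\<exists>U. open U \<and> edom g \<subseteq> U \<and> C1_on f U"
    and g: "proper_fun g" "lower_semicont g"
    and F: "F = (\<lambda>y. f y + g y)"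
    and Fstar: "Fstar = (INF y. F y)" "Fstar > -\<infinity>"
    and h: "no_minfty h" "lower_semicont h" "strictly_convex_fun h"
    and C: "C = interior (edom h)"
    and h_C1: "C1_on h C"
    and argmin: "\<forall>\<gamma>>0. \<forall>y\<in>C \<inter> edom g.
                   bpg_argmin f g h \<gamma> y \<noteq> {} \<and> bpg_argmin f g h \<gamma> y \<subseteq> C \<inter> edom g"
    and L\<^sub>h: "L\<^sub>h > 0"
      "\<forall>y\<in>C \<inter> edom g. \<forall>z\<in>C \<inter> edom g.
         f z \<le> f y + ereal (egrad f y \<bullet> (z - y)) + ereal L\<^sub>h * bregman h z y"
    and \<sigma>: "\<sigma> > 0" "\<forall>z. \<forall>y\<in>C. bregman h z y \<ge> ereal (\<sigma> / 2 * (norm (z - y))\<^sup>2)"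
    and alg: "AC_BPGM f g h \<alpha> L\<^sub>0 x"
    and distinct: "\<forall>k\<ge>1. x k \<noteq> x (k - 1)"
    and \<Delta>: "\<Delta> = real_of_ereal (F (x 0) - Fstar)"
    and Cst: "Cst = ereal (max L\<^sub>0 L\<^sub>h - L\<^sub>0) *
                max_or_0 (AC_Sbar f h \<alpha> L\<^sub>0 x) (\<lambda>l. bregman h (x l) (x (l - 1)))"
  shows "(max_attained (AC_Sbar f h \<alpha> L\<^sub>0 x) (\<lambda>l. bregman h (x l) (x (l - 1)))
          \<and> Cst < \<infinity>
          \<and> (\<forall>k\<ge>1. Min ((\<lambda>l. norm (AC_R f h \<alpha> L\<^sub>0 x l)) ` {1..k})
                \<le> sqrt (4 * \<alpha>\<^sup>2 * max L\<^sub>0 L\<^sub>h * (\<Delta> + real_of_ereal Cst) / ((\<alpha> - 1) * \<sigma> * real k)))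
          \<and> (\<lambda>k::nat. sqrt (4 * \<alpha>\<^sup>2 * max L\<^sub>0 L\<^sub>h * (\<Delta> + real_of_ereal Cst) / ((\<alpha> - 1) * \<sigma> * real k)))
                \<in> O(\<lambda>k. real k powr (-1/2)))
       \<and> (\<exists>c::real. (\<lambda>k. F (x k)) \<longlonglongrightarrow> ereal c)
       \<and> (C = UNIV \<longrightarrow> (\<forall>z. accumulation_point x z \<longrightarrow> l_stationary f g z))"
proof -
  define fr where "fr = (\<lambda>w. real_of_ereal (f w))"
  define gr where "gr = (\<lambda>w. real_of_ereal (g w))"
  define hr where "hr = (\<lambda>w. real_of_ereal (h w))"
  define B where "B z y = hr z - hr y - egrad h y \<bullet> (z - y)" for z y
  define D where "D l = B (x l) (x (l - 1))" for l
  define L where "L = AC_L f h L\<^sub>0 x"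
  define \<gamma> where "\<gamma> = AC_gamma f h L\<^sub>0 x"
  define \<Phi> where "\<Phi> k = fr (x k) + gr (x k)" for k
  define M where "M = max L\<^sub>0 L\<^sub>h"
  obtain U where U: "open U" "edom g \<subseteq> U" "C1_on f U"
    using f_C1 by auto
  have \<alpha>: "1 < \<alpha>" and L\<^sub>0: "0 < L\<^sub>0" and x0: "x 0 \<in> C \<inter> edom g"
    and x_argmin: "\<And>k. x (Suc k) \<in> bpg_argmin f g h (\<alpha> * \<gamma> (Suc k)) (x k)"
    using alg by (auto simp: AC_BPGM_def C \<gamma>_def dest: spec[of _ "Suc _"])
  have fr: "f w = ereal (fr w)" if "w \<in> edom g" for w
    using C1_on_real_of_ereal[OF U(3)] U(2) that by (auto simp: fr_def)
  have hr: "h w = ereal (hr w)" if "w \<in> C" for w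
    using C1_on_real_of_ereal[OF h_C1 that] by (simp add: hr_def)
  have g_gt: "g w > -\<infinity>" for w
    using g(1) by (auto simp: proper_fun_def no_minfty_def)
  have gr: "g w = ereal (gr w)" if "w \<in> edom g" for w
    using that g_gt[of w] by (cases "g w") (auto simp: edom_def gr_def)
  have breg: "bregman h z y = ereal (B z y)" if "z \<in> C" "y \<in> C" for z y
    using that hr by (auto simp: bregman_def B_def C)
  have B_ge: "\<sigma> / 2 * (norm (z - y))\<^sup>2 \<le> B z y" if "z \<in> C" "y \<in> C" for z y
    using \<sigma>(2) that breg[OF that] by (metis ereal_less_eq(3))
  have L_0: "L 0 = L\<^sub>0"
    by (simp add: L_def AC_L_def)
  have \<gamma>_eq: "\<gamma> k = Max (L ` {..<k})" for k
    by (simp add: \<gamma>_def AC_gamma_def L_def)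
  \<comment> \<open>Individual \<open>L k\<close> may be negative, but \<open>L 0\<close> belongs to
    every maximum. This gives the positive parameter that \<open>argmin\<close> asks for.\<close>
  have \<gamma>_ge: "L\<^sub>0 \<le> \<gamma> (Suc k)" for k
    unfolding \<gamma>_eq L_0[symmetric] by (intro Max_ge) auto
  have mem: "x k \<in> C \<inter> edom g" for k
  proof (induction k)
    case (Suc k)
    have "0 < \<alpha> * \<gamma> (Suc k)"
      using \<alpha> L\<^sub>0 \<gamma>_ge[of k] by simp
    then have "bpg_argmin f g h (\<alpha> * \<gamma> (Suc k)) (x k) \<subseteq> C \<inter> edom g"
      using argmin Suc by blast
    then show ?case
      using x_argmin by blast
  qed (rule x0)
  have memC: "x k \<in> C" and memg: "x k \<in> edom g" for k
    using mem by auto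
  have D_Suc: "D (Suc k) = B (x (Suc k)) (x k)" for k
    by (simp add: D_def)
  have D_pos: "0 < D (Suc k)" for k
  proof -
    have "0 < norm (x (Suc k) - x k)"
      using distinct by (metis diff_Suc_1 le_add1 plus_1_eq_Suc right_minus_eq zero_less_norm_iff)
    then have "0 < \<sigma> / 2 * (norm (x (Suc k) - x k))\<^sup>2"
      using \<sigma>(1) by simp
    also have "\<dots> \<le> D (Suc k)"
      unfolding D_Suc using memC by (intro B_ge) auto
    finally show ?thesis .
  qed
  \<comment> \<open>Clearing the denominator is legitimate because distinct iterates and strong
    convexity give \<open>D (Suc k) > 0\<close>.\<close>
  have L_mult_D: "L (Suc k) * D (Suc k) = fr (x (Suc k)) - fr (x k) - egrad f (x k) \<bullet> (x (Suc k) - x k)" for k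
    using D_pos[of k] breg[OF memC memC, of "Suc k" k]
    by (simp add: L_def AC_L_def D_Suc fr_def)
  have L_le: "L k \<le> M" for k
  proof (cases k)
    case 0
    then show ?thesis
      by (simp add: L_0 M_def)
  next
    case (Suc j)
    have "f (x (Suc j)) \<le> f (x j) + ereal (egrad f (x j) \<bullet> (x (Suc j) - x j))
        + ereal L\<^sub>h * bregman h (x (Suc j)) (x j)"
      using L\<^sub>h(2) mem by blast
    then have "L (Suc j) * D (Suc j) \<le> L\<^sub>h * D (Suc j)"
      unfolding L_mult_D using fr[OF memg] breg[OF memC memC] by (simp add: D_Suc)
    then show ?thesis
      using D_pos[of j] Suc by (simp add: M_def)
  qed
  have opt: "egrad f (x k) \<bullet> x (Suc k) + \<alpha> * \<gamma> (Suc k) * B (x (Suc k)) (x k) + gr (x (Suc k))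
      \<le> egrad f (x k) \<bullet> w + \<alpha> * \<gamma> (Suc k) * B w (x k) + gr w"
    if "w \<in> C" "w \<in> edom g" for k w
    using bpg_argmin_le[OF x_argmin, of k w] that
    by (simp add: breg[OF memC memC] breg[OF _ memC] gr memg)
  have F_x: "F (x k) = ereal (\<Phi> k)" for k
    using fr[OF memg] gr[OF memg] by (simp add: F \<Phi>_def)
  obtain m where m: "Fstar = ereal m"
  proof -
    have "Fstar \<le> F (x 0)"
      unfolding Fstar(1) by (intro INF_lower) auto
    with F_x Fstar(2) that show ?thesis
      by (cases Fstar) auto
  qed
  have \<Delta>_eq: "\<Delta> = \<Phi> 0 - m"
    using \<Delta> F_x m by simp
  interpret A: auto_conditioned_descent L D \<Phi> \<alpha> M m
  proof
    show "1 < \<alpha>" "0 < L 0" "L k \<le> M" "0 \<le> D (Suc k)" for k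
      using \<alpha> L\<^sub>0 L_0 L_le D_pos[of k] by auto
    \<comment> \<open>Optimality is tested at \<open>w = x k\<close>, where the Bregman term
      vanishes; \<open>L_mult_D\<close> converts the linear term into a difference of values of
      \<open>f\<close>.\<close>
    show "\<Phi> (Suc k) \<le> \<Phi> k - (\<alpha> * Max (L ` {..<Suc k}) - L (Suc k)) * D (Suc k)" for k
      unfolding left_diff_distrib L_mult_D
      using opt[of "x k" k] memC[of k] memg[of k]
      by (simp add: \<Phi>_def \<gamma>_eq D_Suc B_def[of "x k" "x k"] inner_diff_right)
    show "m \<le> \<Phi> k" for k
    proof -
      have "Fstar \<le> F (x k)"
        unfolding Fstar(1) by (intro INF_lower) auto
      then show ?thesis
        using F_x m by simp
    qed
  qed
  have \<gamma>_gam: "\<gamma> = A.gam"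
    by (auto simp: \<gamma>_eq A.gam_def)
  have Sbar: "AC_Sbar f h \<alpha> L\<^sub>0 x = A.Sbar"
    by (auto simp: AC_Sbar_def AC_S_def A.Sbar_def L_def[symmetric] \<gamma>_def[symmetric] \<gamma>_gam)
  have breg_x: "(\<lambda>l. bregman h (x l) (x (l - 1))) = (\<lambda>l. ereal (D l))"
    using breg[OF memC memC] by (simp add: D_def)
  have attained: "max_attained A.Sbar (\<lambda>l. ereal (D l))"
    using A.finite_Sbar by (rule max_attained_finite)
  moreover have D_nonneg: "0 \<le> D l" if "l \<ge> 1" for l
    using that D_pos[of "l - 1"] by simp
  ultimately obtain c where c: "max_or_0 A.Sbar (\<lambda>l. ereal (D l)) = ereal c" "0 \<le> c"
      "\<And>l. l \<in> A.Sbar \<Longrightarrow> D l \<le> c"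
    using max_or_0_real[of A.Sbar D] by (auto simp: A.Sbar_def)
  have Cst_eq: "Cst = ereal ((M - L\<^sub>0) * c)"
    unfolding Cst Sbar breg_x c(1) by (simp add: M_def)

  \<comment> \<open>Rate of the gradient mapping\<close>
  define K where "K = 4 * \<alpha>\<^sup>2 * M * (\<Delta> + real_of_ereal Cst) / ((\<alpha> - 1) * \<sigma>)"
  have M_pos: "0 < M"
    using L\<^sub>0 by (simp add: M_def)
  have sum_R: "(\<Sum>l=1..k. (norm (AC_R f h \<alpha> L\<^sub>0 x l))\<^sup>2) \<le> K" for k
  proof -
    have "(norm (AC_R f h \<alpha> L\<^sub>0 x l))\<^sup>2 \<le> (2 * \<alpha>\<^sup>2 * M / \<sigma>) * (A.gam l * D l)" if "l \<in> {1..k}" for l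
    proof -
      have gam: "0 < A.gam l" "A.gam l \<le> M"
        using that A.gam_pos A.gam_le by auto
      have "(norm (x (l - 1) - x l))\<^sup>2 \<le> 2 / \<sigma> * D l"
        using B_ge[OF memC memC, of l "l - 1"] \<sigma>(1)
        by (simp add: D_def norm_minus_commute field_simps)
      then have "(\<alpha> * A.gam l)\<^sup>2 * (norm (x (l - 1) - x l))\<^sup>2 \<le> (\<alpha> * A.gam l)\<^sup>2 * (2 / \<sigma> * D l)"
        by (rule mult_left_mono) simp
      \<comment> \<open>One factor \<open>A.gam l\<close> is kept for the weighted sum, the other is
        bounded by \<open>M\<close>.\<close>
      also have "\<dots> = (2 * \<alpha>\<^sup>2 / \<sigma> * (A.gam l * D l)) * A.gam l"
        by (simp add: power2_eq_square)
      also have "\<dots> \<le> (2 * \<alpha>\<^sup>2 / \<sigma> * (A.gam l * D l)) * M"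
        using gam \<sigma>(1) D_nonneg[of l] that by (intro mult_left_mono) auto
      finally show ?thesis
        using gam \<alpha> by (simp add: AC_R_def \<gamma>_def[symmetric] \<gamma>_gam power_mult_distrib mult_ac)
    qed
    then have "(\<Sum>l=1..k. (norm (AC_R f h \<alpha> L\<^sub>0 x l))\<^sup>2)
        \<le> (\<Sum>l=1..k. (2 * \<alpha>\<^sup>2 * M / \<sigma>) * (A.gam l * D l))"
      by (rule sum_mono)
    also have "\<dots> = (2 * \<alpha>\<^sup>2 * M / \<sigma>) * (\<Sum>l=1..k. A.gam l * D l)"
      by (simp add: sum_distrib_left)
    also have "\<dots> \<le> (2 * \<alpha>\<^sup>2 * M / \<sigma>) * ((\<Delta> + real_of_ereal Cst) / ((\<alpha> - 1) / 2))"
    proof (rule mult_left_mono)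
      have "(\<alpha> - 1) / 2 * (\<Sum>l=1..k. A.gam l * D l) \<le> \<Delta> + real_of_ereal Cst"
        using A.sum_gam_D_le[OF c(3) c(2)] by (simp add: \<Delta>_eq Cst_eq L_0)
      then show "(\<Sum>l=1..k. A.gam l * D l) \<le> (\<Delta> + real_of_ereal Cst) / ((\<alpha> - 1) / 2)"
        using \<alpha> by (simp add: pos_le_divide_eq mult.commute)
      show "0 \<le> 2 * \<alpha>\<^sup>2 * M / \<sigma>"
        using M_pos \<sigma>(1) by simp
    qed
    also have "\<dots> = K"
      unfolding K_def by (simp only: times_divide_times_eq divide_divide_eq_right times_divide_eq_right) (simp add: mult_ac)
    finally show ?thesis .
  qed
  have bound_eq: "4 * \<alpha>\<^sup>2 * max L\<^sub>0 L\<^sub>h * (\<Delta> + real_of_ereal Cst) / ((\<alpha> - 1) * \<sigma> * real k) = K / real k" for k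
    by (simp add: K_def M_def)
  have min_R: "Min ((\<lambda>l. norm (AC_R f h \<alpha> L\<^sub>0 x l)) ` {1..k}) \<le> sqrt (K / real k)" if "1 \<le> k" for k
  proof (rule real_le_rsqrt)
    define r where "r = Min ((\<lambda>l. norm (AC_R f h \<alpha> L\<^sub>0 x l)) ` {1..k})"
    have "0 \<le> r"
      unfolding r_def using that by (intro Min.boundedI) auto
    have "r\<^sup>2 \<le> (norm (AC_R f h \<alpha> L\<^sub>0 x l))\<^sup>2" if "l \<in> {1..k}" for l
      using \<open>0 \<le> r\<close> that by (intro power_mono) (auto simp: r_def)
    then have "real (card {1..k}) * r\<^sup>2 \<le> (\<Sum>l=1..k. (norm (AC_R f h \<alpha> L\<^sub>0 x l))\<^sup>2)"
      by (rule sum_bounded_below)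
    then have "r\<^sup>2 * real k \<le> K"
      using sum_R[of k] by (simp add: mult.commute)
    then show "r\<^sup>2 \<le> K / real k"
      using that by (simp add: pos_le_divide_eq)
  qed
  have rate: "(\<lambda>k. sqrt (K / real k)) \<in> O(\<lambda>k. real k powr (-1/2))"
  proof (rule bigoI)
    \<comment> \<open>The absolute value in the constant avoids a separate proof that
      \<open>K\<close> is nonnegative.\<close>
    show "eventually (\<lambda>k. norm (sqrt (K / real k)) \<le> \<bar>sqrt K\<bar> * norm (real k powr (-1/2))) sequentially"
      using eventually_gt_at_top[of 0]
    proof eventually_elim
      case (elim k)
      then have "sqrt (K / real k) = sqrt K * real k powr (-1/2)"
        using powr_minus_divide[of "real k" "1/2"] by (simp add: real_sqrt_divide powr_half_sqrt)
      then show ?case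
        by (simp add: abs_mult)
    qed
  qed
  have conv: "\<exists>c. (\<lambda>k. F (x k)) \<longlonglongrightarrow> ereal c"
    using A.value_convergent by (auto simp: convergent_def F_x)

  \<comment> \<open>Stationarity of accumulation points\<close>
  have stationary: "l_stationary f g z" if C_UNIV: "C = UNIV" and acc: "accumulation_point x z" for z
  proof -
    obtain r where r: "strict_mono r" "(x \<circ> r) \<longlonglongrightarrow> z"
      using acc by (auto simp: accumulation_point_def)
    \<comment> \<open>The predecessors of the selected indices. Starting at
      \<open>r (Suc j)\<close>, which is at least 1, keeps the natural subtraction exact even if
      \<open>r 0 = 0\<close>.\<close>
    define s where "s j = r (Suc j) - 1" for j
    have s_Suc: "Suc (s j) = r (Suc j)" for j
      using strict_mono_imp_increasing[OF r(1), of "Suc j"] by (simp add: s_def)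
    have s_mono: "strict_mono s"
      using r(1) s_Suc by (metis Suc_less_eq strict_mono_Suc_iff)
    define \<xi> where "\<xi> j = egrad f (x (Suc (s j))) - egrad f (x (s j))
      - (\<alpha> * \<gamma> (Suc (s j))) *\<^sub>R (egrad h (x (Suc (s j))) - egrad h (x (s j)))" for j
    have x_lim: "(\<lambda>j. x (Suc (s j))) \<longlonglongrightarrow> z"
      using LIMSEQ_Suc[OF r(2)] by (simp add: s_Suc)
    have D_lim: "(\<lambda>j. D (Suc (s j))) \<longlonglongrightarrow> 0"
      using LIMSEQ_subseq_LIMSEQ[OF LIMSEQ_Suc[OF A.D_tendsto_0] s_mono] by (simp add: o_def)
    \<comment> \<open>Strong convexity turns vanishing Bregman distances into vanishing steps, so
      the predecessors also converge to \<open>z\<close>.\<close>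
    have "(\<lambda>j. x (Suc (s j)) - x (s j)) \<longlonglongrightarrow> 0"
    proof (rule tendsto_norm_zero_cancel, rule tendsto_sandwich[OF _ _ tendsto_const])
      show "(\<lambda>j. sqrt (2 / \<sigma> * D (Suc (s j)))) \<longlonglongrightarrow> 0"
        using tendsto_real_sqrt[OF tendsto_mult_right_zero[OF D_lim, of "2 / \<sigma>"]] by simp
      have "norm (x (Suc k) - x k) \<le> sqrt (2 / \<sigma> * D (Suc k))" for k
        using B_ge[OF memC memC, of "Suc k" k] \<sigma>(1)
        by (intro real_le_rsqrt) (simp add: D_Suc field_simps)
      then show "eventually (\<lambda>j. norm (x (Suc (s j)) - x (s j)) \<le> sqrt (2 / \<sigma> * D (Suc (s j)))) sequentially"
        by simp
    qed simp
    from tendsto_diff[OF x_lim this] have y_lim: "(\<lambda>j. x (s j)) \<longlonglongrightarrow> z"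
      by simp
    have \<gamma>_bounded: "Bseq (\<lambda>j. \<alpha> * \<gamma> (Suc (s j)))"
    proof (rule BseqI')
      show "norm (\<alpha> * \<gamma> (Suc (s j))) \<le> \<alpha> * M" for j
        using \<alpha> A.gam_pos[of "Suc (s j)"] A.gam_le[of "Suc (s j)"] by (simp add: \<gamma>_gam abs_mult)
    qed
    \<comment> \<open>Stated for any normed space, since it serves both real Bregman terms and
      gradient differences.\<close>
    have \<gamma>_mult_lim: "(\<lambda>j. (\<alpha> * \<gamma> (Suc (s j))) *\<^sub>R v j) \<longlonglongrightarrow> 0"
      if "v \<longlonglongrightarrow> 0" for v :: "nat \<Rightarrow> 'b::real_normed_vector"
      using bounded_bilinear.Bfun_prod_Zfun[OF bounded_bilinear_scaleR] \<gamma>_bounded that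
      by (simp add: tendsto_Zfun_iff)
    obtain c where "\<Phi> \<longlonglongrightarrow> c"
      using A.value_convergent by (auto simp: convergent_def)
    then have \<Phi>_lim: "(\<lambda>j. \<Phi> (Suc (s j))) \<longlonglongrightarrow> c"
      using LIMSEQ_subseq_LIMSEQ[OF LIMSEQ_Suc s_mono] by (simp add: o_def)

    text \<open>Before \<open>z \<in> edom g\<close> is known, \<open>f\<close> need not be finite or continuous at \<open>z\<close>, so only its lower
      semicontinuity is used here.\<close>
    have "- \<infinity> < f z"
      using f(1) by (simp add: no_minfty_def)
    then obtain b where b: "ereal b < f z"
      using ereal_dense2 by blast
    obtain N where N: "\<And>j. j \<ge> N \<Longrightarrow> ereal b < f (x (Suc (s j)))"
      using lower_semicont_eventually[OF f(2) b x_lim] by (auto simp: eventually_sequentially)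
    have "g z \<le> ereal (c - b)"
    proof (rule lower_semicont_le_lim[OF g(2)])
      show "(\<lambda>j. x (Suc (s (j + N)))) \<longlonglongrightarrow> z"
        using LIMSEQ_ignore_initial_segment[OF x_lim] .
      show "(\<lambda>j. \<Phi> (Suc (s (j + N))) - b) \<longlonglongrightarrow> c - b"
        using LIMSEQ_ignore_initial_segment[OF \<Phi>_lim, of N] by (intro tendsto_intros)
      show "g (x (Suc (s (j + N)))) \<le> ereal (\<Phi> (Suc (s (j + N))) - b)" for j
        using N[of "j + N"] fr[OF memg] gr[OF memg] by (simp add: \<Phi>_def)
    qed
    then have z: "z \<in> edom g"
      using le_less_trans by (fastforce simp: edom_def)
    have zC: "z \<in> C" "z \<in> U"
      using C_UNIV z U(2) by auto
    have hC: "edom h = UNIV" "C1_on h UNIV"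
      using C_UNIV C h_C1 interior_subset[of "edom h"] by auto
    have cont: "isCont fr z" "isCont hr z" "isCont (egrad f) z" "isCont (egrad h) z"
      unfolding fr_def hr_def
      using GDERIV_imp_isCont C1_on_GDERIV U zC hC
      by (blast, blast, auto simp: C1_on_def continuous_on_eq_continuous_at)
    note lims = isCont_tendsto_compose[OF cont(1) x_lim] isCont_tendsto_compose[OF cont(1) y_lim]
      isCont_tendsto_compose[OF cont(2) x_lim] isCont_tendsto_compose[OF cont(2) y_lim]
      isCont_tendsto_compose[OF cont(3) x_lim] isCont_tendsto_compose[OF cont(3) y_lim]
      isCont_tendsto_compose[OF cont(4) x_lim] isCont_tendsto_compose[OF cont(4) y_lim]
    \<comment> \<open>Optimality tested against \<open>z\<close> and solved for
      \<open>gr (x (Suc (s j)))\<close>; \<open>a j\<close> is the resulting upper bound.\<close>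
    define a where "a j = gr z + egrad f (x (s j)) \<bullet> (z - x (Suc (s j)))
      + (\<alpha> * \<gamma> (Suc (s j))) *\<^sub>R (B z (x (s j)) - D (Suc (s j)))" for j
    have "(\<lambda>j. B z (x (s j)) - D (Suc (s j))) \<longlonglongrightarrow> (hr z - hr z - egrad h z \<bullet> (z - z)) - 0"
      unfolding B_def by (intro tendsto_intros lims D_lim y_lim)
    then have "(\<lambda>j. (\<alpha> * \<gamma> (Suc (s j))) *\<^sub>R (B z (x (s j)) - D (Suc (s j)))) \<longlonglongrightarrow> 0"
      by (intro \<gamma>_mult_lim) simp
    then have "a \<longlonglongrightarrow> gr z + egrad f z \<bullet> (z - z) + 0"
      unfolding a_def by (intro tendsto_intros lims x_lim)
    then have a_lim: "a \<longlonglongrightarrow> gr z"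
      by simp
    have g_le: "gr (x (Suc (s j))) \<le> a j" for j
      using opt[OF zC(1) z, of "s j"] by (simp add: a_def D_Suc inner_diff_right algebra_simps)
    \<comment> \<open>Lower semicontinuity gives the lower half, the bound \<open>a\<close> the
      upper half. The limiting subdifferential requires convergence of values as well as of
      points.\<close>
    have g_lim: "(\<lambda>j. gr (x (Suc (s j)))) \<longlonglongrightarrow> gr z"
    proof (rule order_tendstoI)
      fix t assume "t < gr z"
      then have "eventually (\<lambda>j. ereal t < g (x (Suc (s j)))) sequentially"
        using gr[OF z] by (intro lower_semicont_eventually[OF g(2) _ x_lim]) auto
      then show "eventually (\<lambda>j. t < gr (x (Suc (s j)))) sequentially"
        by (simp add: gr[OF memg])
    next
      fix t assume "gr z < t"
      with a_lim have "eventually (\<lambda>j. a j < t) sequentially"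
        by (rule order_tendstoD)
      then show "eventually (\<lambda>j. gr (x (Suc (s j))) < t) sequentially"
        by eventually_elim (use g_le le_less_trans in blast)
    qed
    have F_lim: "(\<lambda>j. f (x (Suc (s j))) + g (x (Suc (s j)))) \<longlonglongrightarrow> f z + g z"
      using tendsto_add[OF lims(1) g_lim] by (simp add: fr[OF memg] gr[OF memg] fr[OF z] gr[OF z])
    have "(\<lambda>j. egrad h (x (Suc (s j))) - egrad h (x (s j))) \<longlonglongrightarrow> 0"
      using tendsto_diff[OF lims(7,8)] by simp
    \<comment> \<open>Both shifted subsequences converge to \<open>z\<close>, where the gradients
      are continuous; boundedness of \<gamma> controls the kernel term.\<close>
    from tendsto_diff[OF tendsto_diff[OF lims(5,6)] \<gamma>_mult_lim[OF this]] have "\<xi> \<longlonglongrightarrow> 0"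
      by (simp add: \<xi>_def[abs_def])
    moreover have "\<xi> j \<in> frechet_subdiff (\<lambda>w. f w + g w) (x (Suc (s j)))" for j
      unfolding \<xi>_def using g(1)
      by (intro bpg_argmin_frechet_subdiff[OF x_argmin memg hC U]) (simp add: proper_fun_def)
    ultimately have "0 \<in> limiting_subdiff (\<lambda>w. f w + g w) z"
      unfolding limiting_subdiff_def using x_lim F_lim by blast
    with z show ?thesis
      by (simp add: l_stationary_def)
  qed
  show ?thesis
    unfolding bound_eq Sbar breg_x using attained Cst_eq min_R rate conv stationary by simp
qed

end
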